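(* Let $J$ be an information matrix (a real symmetric positive definite matrix) whose associated graph is a tree $\mathcal{T}$ (apart from self-loops), and let $\Sigma=J^{-1}$. For each vertex $\alpha$ put $\hat J_\alpha:=1/\Sigma_{\alpha\alpha}$, and for each ordered pair of distinct adjacent vertices $\alpha,\beta$ define $\hat J_{\beta\setminus\alpha}$ by $\hat J_{\beta\setminus\alpha}^{-1}:=\big((J_{\mathcal{T}\setminus\{\alpha\}})^{-1}\big)_{\beta\beta}$, and set $\Delta J_{\beta\to\alpha}:=-J_{\alpha\beta}\,\hat J_{\beta\setminus\alpha}^{-1}\,J_{\beta\alpha}$. Then these quantities satisfy the Gaussian belief propagation equations: for every vertex $\alpha$, $$\hat J_\alpha=J_{\alpha\alpha}+\sum_{\beta\in\mathcal{N}(\alpha)}\Delta J_{\beta\to\alpha},$$ and for every vertex $\alpha$ and every $\beta\in\mathcal{N}(\alpha)$, $$\hat J_{\beta\setminus\alpha}=J_{\beta\beta}+\sum_{\delta\in\mathcal{N}(\beta)\setminus\{\alpha\}}\Delta J_{\delta\to\beta}.$$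
   Context: The graph associated with the $n\times n$ symmetric matrix $J$ has vertex set $\{1,\dots,n\}$ and an edge $(i,j)$ if and only if $J_{ij}\neq 0$ (diagonal entries give self-loops, which are disregarded when saying that the graph is a tree). $\mathcal{N}(\alpha)$ is the set of neighbours of $\alpha$ on $\mathcal{T}$, i.e. vertices $\beta\neq\alpha$ with $J_{\alpha\beta}\ne 0$. $\mathcal{T}\setminus\{\alpha\}$ is $\mathcal{T}$ with the vertex $\alpha$ and all its incident edges deleted, and $J_{\mathcal{T}\setminus\{\alpha\}}$ is the principal submatrix of $J$ obtained by deleting the row and column $\alpha$; its entries keep the original vertex labels as indices. *)

theory Defs
  imports "HOL-Analysis.Analysis"
begin

definition information_matrix :: "real^'n^'n \<Rightarrow> bool" where
  "information_matrix J \<longleftrightarrow>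
     transpose J = J \<and> (\<forall>x. x \<noteq> 0 \<longrightarrow> 0 < x \<bullet> (J *v x))"

(* The graph of a matrix, with the self-loops coming from the diagonal left out. *)
definition adjacent :: "real^'n^'n \<Rightarrow> 'n \<Rightarrow> 'n \<Rightarrow> bool" where
  "adjacent J i j \<longleftrightarrow> i \<noteq> j \<and> J $ i $ j \<noteq> 0"

definition neighbours :: "real^'n^'n \<Rightarrow> 'n \<Rightarrow> 'n set" where
  "neighbours J i = {j. adjacent J i j}"

(* The list contains each vertex of the cycle once; the last vertex is joined back to the first. *)
definition graph_cycle :: "('v \<Rightarrow> 'v \<Rightarrow> bool) \<Rightarrow> 'v list \<Rightarrow> bool" where
  "graph_cycle E p \<longleftrightarrow>
     3 \<le> length p \<and> distinct p \<and> successively E p \<and> E (last p) (hd p)"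

(* Undirected trees, for a symmetric irreflexive E whose vertex set is the whole type. *)
definition graph_tree :: "('v \<Rightarrow> 'v \<Rightarrow> bool) \<Rightarrow> bool" where
  "graph_tree E \<longleftrightarrow> (\<forall>u v. E\<^sup>*\<^sup>* u v) \<and> (\<nexists>p. graph_cycle E p)"

(* Matrices whose rows and columns are labelled by the elements of a set S are functions
   of two labels, of which only the values on S \<times> S are meaningful. *)
definition inverts_on ::
  "'v set \<Rightarrow> ('v \<Rightarrow> 'v \<Rightarrow> real) \<Rightarrow> ('v \<Rightarrow> 'v \<Rightarrow> real) \<Rightarrow> bool" where
  "inverts_on S A B \<longleftrightarrow>
     (\<forall>i\<in>S. \<forall>j\<in>S.
        (\<Sum>k\<in>S. A i k * B k j) = (if i = j then 1 else 0) \<and>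
        (\<Sum>k\<in>S. B i k * A k j) = (if i = j then 1 else 0))"

(* The choice is unique on S \<times> S, see inverts_on_unique. *)
definition inv_on :: "'v set \<Rightarrow> ('v \<Rightarrow> 'v \<Rightarrow> real) \<Rightarrow> 'v \<Rightarrow> 'v \<Rightarrow> real" where
  "inv_on S A = (SOME B. inverts_on S A B)"

(* Inverse of the principal submatrix with row and column a deleted, original labels kept. *)
definition deleted_inv :: "real^'n^'n \<Rightarrow> 'n \<Rightarrow> 'n \<Rightarrow> 'n \<Rightarrow> real" where
  "deleted_inv J a = inv_on (UNIV - {a}) (\<lambda>i j. J $ i $ j)"

definition J_hat :: "real^'n^'n \<Rightarrow> 'n \<Rightarrow> real" where
  "J_hat J a = 1 / (matrix_inv J $ a $ a)"

(* J_cavity J b a is the quantity with subscript b \ a. *)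
definition J_cavity :: "real^'n^'n \<Rightarrow> 'n \<Rightarrow> 'n \<Rightarrow> real" where
  "J_cavity J b a = inverse (deleted_inv J a b b)"

(* J_message J b a is the message from b to a. *)
definition J_message :: "real^'n^'n \<Rightarrow> 'n \<Rightarrow> 'n \<Rightarrow> real" where
  "J_message J b a = - (J $ a $ b * inverse (J_cavity J b a) * J $ b $ a)"

lemma inverts_on_unique:
  assumes S: "finite S" and B: "inverts_on S A B" and C: "inverts_on S A C"
    and i: "i \<in> S" and j: "j \<in> S"
  shows "B i j = C i j"
proof -
  have "B i j = (\<Sum>k\<in>S. B i k * (if k = j then 1 else 0))"
    using S j by (simp add: if_distrib cong: if_cong)
  also have "\<dots> = (\<Sum>k\<in>S. B i k * (\<Sum>l\<in>S. A k l * C l j))"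
    using C j by (intro sum.cong) (auto simp: inverts_on_def)
  also have "\<dots> = (\<Sum>l\<in>S. (\<Sum>k\<in>S. B i k * A k l) * C l j)"
    by (simp add: sum_distrib_left sum_distrib_right mult.assoc) (rule sum.swap)
  also have "\<dots> = (\<Sum>l\<in>S. (if i = l then 1 else 0) * C l j)"
    using B i by (intro sum.cong) (auto simp: inverts_on_def)
  also have "\<dots> = C i j"
    using S i by (simp add: if_distrib[of "\<lambda>x. x * _"] cong: if_cong)
  finally show ?thesis .
qed

lemma inverts_on_UNIV_iff:
  fixes A B :: "real^'n^'n"
  shows "inverts_on UNIV (\<lambda>i j. A $ i $ j) (\<lambda>i j. B $ i $ j) \<longleftrightarrow>
           A ** B = mat 1 \<and> B ** A = mat 1"
  by (auto simp: inverts_on_def matrix_matrix_mult_def mat_def vec_eq_iff)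

end

theory Submission
  imports Defs
begin

text \<open>
  Let \<open>B\<close> invert the submatrix of \<open>J\<close> on \<open>S\<close>, let \<open>a \<in> S\<close>, and let \<open>x\<close> be the column \<open>a\<close> of \<open>B\<close>.
  For a neighbour \<open>b\<close> of \<open>a\<close>, let \<open>C\<close> be the branch at \<open>b\<close>, that is the component of \<open>b\<close> after deletion
  of \<open>a\<close>. As \<open>b\<close> is the only vertex of \<open>C\<close> adjacent to \<open>a\<close>, the rows of \<open>J x = e\<^sub>a\<close> in \<open>C\<close>
  give \<open>x\<^sub>b = - G\<^sub>b\<^sub>b J\<^sub>b\<^sub>a x\<^sub>a\<close>, where \<open>G\<close> is the inverse of \<open>J\<close> on \<open>C\<close>. Row \<open>a\<close> then reads
  \<open>x\<^sub>a (J\<^sub>a\<^sub>a - \<Sum>\<^sub>b J\<^sub>a\<^sub>b G\<^sub>b\<^sub>b J\<^sub>b\<^sub>a) = 1\<close>. Because \<open>C\<close> is a diagonal block of the matrix with row and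
  column \<open>a\<close> deleted, \<open>G\<^sub>b\<^sub>b\<close> is also an entry of the inverse of that larger matrix. Taking for
  \<open>S\<close> all vertices yields the first equation; taking all vertices but one neighbour of \<open>a\<close> yields
  the second, since the branches at the other neighbours are unchanged.
\<close>

text \<open>With \<open>i\<close> or \<open>j\<close> in \<open>C\<close>, terms with
  \<open>k\<close> in \<open>S - C\<close> vanish because \<open>A\<close> does, so the sums over
  \<open>S\<close> shrink to \<open>C\<close>. No zeros of \<open>B\<close> are needed.\<close>

lemma inverts_on_block:
  assumes inv: "inverts_on S A B" and fin: "finite S" and sub: "C \<subseteq> S"
    and block: "\<And>i k. i \<in> C \<Longrightarrow> k \<in> S - C \<Longrightarrow> A i k = 0 \<and> A k i = 0"
  shows "inverts_on C A B"
  unfolding inverts_on_def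
proof (intro ballI conjI)
  fix i j assume ij: "i \<in> C" "j \<in> C"
  have "(\<Sum>k\<in>C. A i k * B k j) = (\<Sum>k\<in>S. A i k * B k j)"
    using block ij by (intro sum.mono_neutral_left fin sub) auto
  then show "(\<Sum>k\<in>C. A i k * B k j) = (if i = j then 1 else 0)"
    using inv ij sub by (simp add: inverts_on_def subset_iff)
  have "(\<Sum>k\<in>C. B i k * A k j) = (\<Sum>k\<in>S. B i k * A k j)"
    using block ij by (intro sum.mono_neutral_left fin sub) auto
  then show "(\<Sum>k\<in>C. B i k * A k j) = (if i = j then 1 else 0)"
    using inv ij sub by (simp add: inverts_on_def subset_iff)
qed

lemma information_matrix_sym:
  assumes "information_matrix J"
  shows "J $ i $ j = J $ j $ i"
  using assms unfolding information_matrix_def by (metis transpose_def vec_lambda_beta)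

lemma information_matrix_inverts_on_exists:
  fixes J :: "real^'n^'n"
  assumes J: "information_matrix J"
  shows "\<exists>B. inverts_on S (\<lambda>i j. J $ i $ j) B"
proof -
  \<comment> \<open>\<open>M\<close> pads the principal submatrix with an identity block. A kernel
    vector of \<open>M\<close> vanishes off \<open>S\<close> and is thus null for the quadratic form
    of \<open>J\<close>; definiteness forces it to be 0.\<close>
  define M :: "real^'n^'n" where
    "M = (\<chi> i j. if i \<in> S \<and> j \<in> S then J $ i $ j else if i = j then 1 else 0)"
  have "x = 0" if Mx: "M *v x = 0" for x
  proof -
    have row: "(\<Sum>k\<in>UNIV. M $ i $ k * x $ k) = 0" for i
      using Mx by (simp add: matrix_vector_mult_def vec_eq_iff)
    have out: "x $ i = 0" if "i \<notin> S" for i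
      using row[of i] that by (simp add: M_def if_distrib[of "\<lambda>y. y * _"] cong: if_cong)
    have "(J *v x) $ i = 0" if i: "i \<in> S" for i
    proof -
      have "(J *v x) $ i = (\<Sum>k\<in>UNIV. M $ i $ k * x $ k)"
        unfolding matrix_vector_mult_def using out i by (auto simp: M_def intro!: sum.cong)
      then show ?thesis using row by simp
    qed
    then have "x \<bullet> (J *v x) = 0"
      unfolding inner_vec_def using out by (intro sum.neutral) auto
    then show ?thesis using J by (auto simp: information_matrix_def)
  qed
  then obtain N where "N ** M = mat 1"
    using matrix_left_invertible_ker[of M] by blast
  then have "inverts_on UNIV (\<lambda>i j. M $ i $ j) (\<lambda>i j. N $ i $ j)"
    by (simp add: inverts_on_UNIV_iff matrix_left_right_inverse)
  then have "inverts_on S (\<lambda>i j. M $ i $ j) (\<lambda>i j. N $ i $ j)"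
    by (rule inverts_on_block) (auto simp: M_def)
  then have "inverts_on S (\<lambda>i j. J $ i $ j) (\<lambda>i j. N $ i $ j)"
    by (simp add: inverts_on_def M_def)
  then show ?thesis by blast
qed

lemma inverts_on_deleted_inv:
  assumes "information_matrix J"
  shows "inverts_on (UNIV - {a}) (\<lambda>i j. J $ i $ j) (deleted_inv J a)"
  unfolding deleted_inv_def inv_on_def
  by (rule someI_ex[OF information_matrix_inverts_on_exists[OF assms]])

lemma inverts_on_matrix_inv:
  fixes J :: "real^'n^'n"
  assumes "information_matrix J"
  shows "inverts_on UNIV (\<lambda>i j. J $ i $ j) (\<lambda>i j. matrix_inv J $ i $ j)"
proof -
  obtain B where "inverts_on UNIV (\<lambda>i j. J $ i $ j) B"
    using information_matrix_inverts_on_exists[OF assms] by blast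
  then have "inverts_on UNIV (\<lambda>i j. J $ i $ j) (\<lambda>i j. (\<chi> i j. B i j) $ i $ j)"
    by simp
  then have "invertible J"
    unfolding inverts_on_UNIV_iff invertible_def by blast
  then show ?thesis
    unfolding inverts_on_UNIV_iff invertible_def matrix_inv_def by (rule someI_ex)
qed

lemma rtranclp_distinct_path:
  assumes "R\<^sup>*\<^sup>* x y"
  shows "\<exists>p. p \<noteq> [] \<and> distinct p \<and> successively R p \<and> hd p = x \<and> last p = y \<and>
           set p \<subseteq> {v. R\<^sup>*\<^sup>* x v}"
  using assms
proof (induction rule: rtranclp_induct)
  case base
  show ?case by (rule exI[of _ "[x]"]) simp
next
  case (step y z)
  then obtain p where p: "p \<noteq> []" "distinct p" "successively R p" "hd p = x" "last p = y"
    "set p \<subseteq> {v. R\<^sup>*\<^sup>* x v}" by blast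
  show ?case
  proof (cases "z \<in> set p")
    case True
    \<comment> \<open>The path already visits \<open>z\<close>: cut it there instead of extending
      it.\<close>
    then obtain q r where qr: "p = (q @ [z]) @ r"
      by (metis append.assoc append_Cons append_Nil split_list)
    moreover have "successively R (q @ [z])"
      using p(3) unfolding qr successively_append_iff by blast
    moreover have "hd (q @ [z]) = x"
      using p(4) qr by (cases q) auto
    ultimately show ?thesis
      using p by (intro exI[of _ "q @ [z]"]) auto
  next
    case False
    with p step show ?thesis
      by (intro exI[of _ "p @ [z]"])
        (auto simp: successively_append_iff intro: rtranclp.rtrancl_into_rtrancl)
  qed
qed

definition branch :: "('v \<Rightarrow> 'v \<Rightarrow> bool) \<Rightarrow> 'v \<Rightarrow> 'v \<Rightarrow> 'v set" where
  "branch E a b = {v. (\<lambda>u v. E u v \<and> u \<noteq> a \<and> v \<noteq> a)\<^sup>*\<^sup>* b v}"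

lemma branch_self: "b \<in> branch E a b"
  by (simp add: branch_def)

lemma branch_avoids:
  assumes "b \<noteq> a" "v \<in> branch E a b"
  shows "v \<noteq> a"
  using assms(2) unfolding branch_def mem_Collect_eq
  by (induction rule: rtranclp_induct) (use assms(1) in auto)

lemma branch_step:
  assumes "b \<noteq> a" "u \<in> branch E a b" "E u v" "v \<noteq> a"
  shows "v \<in> branch E a b"
  using branch_avoids[OF assms(1,2)] assms(2-4) unfolding branch_def mem_Collect_eq
  by (auto intro: rtranclp.rtrancl_into_rtrancl)

text \<open>A path from \<open>b\<close> to a different neighbour \<open>v\<close> inside the branch
  avoids \<open>a\<close>, so \<open>a\<close> would close it to a cycle.\<close>

lemma branch_attached_once:
  assumes tree: "graph_tree E" and sym: "\<And>u v. E u v \<Longrightarrow> E v u" and irrefl: "\<And>u. \<not> E u u"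
    and ab: "E a b" and av: "E a v" and v: "v \<in> branch E a b"
  shows "v = b"
proof (rule ccontr)
  assume "v \<noteq> b"
  have "b \<noteq> a" using ab irrefl by auto
  obtain p where p: "p \<noteq> []" "distinct p"
    "successively (\<lambda>u v. E u v \<and> u \<noteq> a \<and> v \<noteq> a) p" "hd p = b" "last p = v"
    "set p \<subseteq> branch E a b"
    using rtranclp_distinct_path[OF v[unfolded branch_def mem_Collect_eq]]
    unfolding branch_def by auto
  have "a \<notin> set p" using branch_avoids[OF \<open>b \<noteq> a\<close>] p(6) by blast
  moreover have "2 \<le> length p"
    using p \<open>v \<noteq> b\<close> by (cases p; cases "tl p") auto
  moreover have "successively E p"
    using p(3) by (rule successively_mono) auto
  ultimately have "graph_cycle E (a # p)"
    using p ab sym[OF av] by (auto simp: graph_cycle_def successively_Cons)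
  then show False using tree by (auto simp: graph_tree_def)
qed

text \<open>Stated as a product so that \<open>B a a \<noteq> 0\<close> comes out as well.\<close>

lemma inverts_on_diagonal_branches:
  assumes inv: "inverts_on S A B" and fin: "finite S" and a: "a \<in> S"
    and N: "N = {b \<in> S - {a}. A a b \<noteq> 0}"
    and C: "\<And>b. b \<in> N \<Longrightarrow> C b \<subseteq> S - {a}" "\<And>b. b \<in> N \<Longrightarrow> b \<in> C b"
    and block: "\<And>b i k. b \<in> N \<Longrightarrow> i \<in> C b \<Longrightarrow> k \<in> S - {a} - C b \<Longrightarrow> A i k = 0"
    and once: "\<And>b i. b \<in> N \<Longrightarrow> i \<in> C b \<Longrightarrow> i \<noteq> b \<Longrightarrow> A i a = 0"
    and G: "\<And>b. b \<in> N \<Longrightarrow> inverts_on (C b) A (G b)"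
  shows "B a a * (A a a + (\<Sum>b\<in>N. - (A a b * G b b b * A b a))) = 1"
proof -
  have x: "B b a = - (G b b b * A b a * B a a)" if b: "b \<in> N" for b
  proof -
    have finC: "finite (C b)" and sub: "C b \<subseteq> S" and aC: "a \<notin> C b"
      using C(1)[OF b] fin by (auto intro: finite_subset)
    \<comment> \<open>Since \<open>i\<close> differs from \<open>a\<close>, the entry of
      \<open>A B\<close> at \<open>(i, a)\<close> is 0; by \<open>block\<close> only columns in
      \<open>C b\<close> and column \<open>a\<close> contribute.\<close>
    have row: "(\<Sum>k\<in>C b. A i k * B k a) = - (A i a * B a a)" if i: "i \<in> C b" for i
    proof -
      have "0 = (\<Sum>k\<in>S. A i k * B k a)"
        using inv i a sub aC by (auto simp: inverts_on_def subset_iff)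
      also have "\<dots> = (\<Sum>k\<in>insert a (C b). A i k * B k a)"
        using block[OF b i] fin sub a by (intro sum.mono_neutral_right) auto
      also have "\<dots> = A i a * B a a + (\<Sum>k\<in>C b. A i k * B k a)"
        using finC aC by simp
      finally show ?thesis by simp
    qed
    have "B b a = (\<Sum>k\<in>C b. (if b = k then 1 else 0) * B k a)"
      using finC C(2)[OF b] by (simp add: if_distrib[of "\<lambda>x. x * _"] cong: if_cong)
    also have "\<dots> = (\<Sum>k\<in>C b. (\<Sum>i\<in>C b. G b b i * A i k) * B k a)"
      using G[OF b] C(2)[OF b] by (intro sum.cong) (auto simp: inverts_on_def)
    also have "\<dots> = (\<Sum>i\<in>C b. G b b i * (\<Sum>k\<in>C b. A i k * B k a))"
      by (simp add: sum_distrib_left sum_distrib_right mult.assoc) (rule sum.swap)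
    also have "\<dots> = (\<Sum>i\<in>C b. if i = b then - (G b b b * A b a * B a a) else 0)"
      using row once[OF b] by (intro sum.cong) auto
    also have "\<dots> = - (G b b b * A b a * B a a)"
      using finC C(2)[OF b] by simp
    finally show ?thesis .
  qed
  have "1 = (\<Sum>k\<in>S. A a k * B k a)"
    using inv a by (simp add: inverts_on_def)
  also have "\<dots> = (\<Sum>k\<in>insert a N. A a k * B k a)"
    using fin a N by (intro sum.mono_neutral_right) auto
  also have "\<dots> = A a a * B a a + (\<Sum>b\<in>N. A a b * B b a)"
    using fin N by simp
  also have "(\<Sum>b\<in>N. A a b * B b a) = (\<Sum>b\<in>N. B a a * - (A a b * G b b b * A b a))"
    using x by (intro sum.cong) auto
  finally show ?thesis
    by (simp add: sum_distrib_left algebra_simps)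
qed

text \<open>The condition on \<open>- S\<close> covers both equations. It keeps the branches at the
  remaining neighbours inside \<open>S\<close>: a vertex of such a branch outside \<open>S\<close>
  would be a second neighbour of \<open>a\<close> there.\<close>

lemma tree_inverse_diagonal:
  fixes J :: "real^'n^'n"
  assumes J: "information_matrix J" and tree: "graph_tree (adjacent J)"
    and inv: "inverts_on S (\<lambda>i j. J $ i $ j) B" and a: "a \<in> S"
    and S: "- S \<subseteq> neighbours J a"
  shows "inverse (B a a) = J $ a $ a + (\<Sum>b\<in>neighbours J a \<inter> S. J_message J b a)"
proof -
  let ?A = "\<lambda>i j. J $ i $ j"
  let ?C = "branch (adjacent J) a"
  let ?N = "neighbours J a \<inter> S"
  note sym = information_matrix_sym[OF J]
  have adj_sym: "adjacent J u v \<Longrightarrow> adjacent J v u" for u v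
    using sym[of u v] by (auto simp: adjacent_def)
  have irrefl: "\<not> adjacent J u u" for u
    by (simp add: adjacent_def)
  have once: "v = b" if "b \<in> neighbours J a" "adjacent J a v" "v \<in> ?C b" for b v
    using branch_attached_once[OF tree adj_sym irrefl _ that(2,3)] that(1)
    by (simp add: neighbours_def)
  have ne: "b \<noteq> a" if "b \<in> ?N" for b
    using that by (auto simp: neighbours_def adjacent_def)
  have closed: "J $ i $ k = 0" if "b \<in> ?N" "i \<in> ?C b" "k \<noteq> a" "k \<notin> ?C b" for b i k
    using branch_step[of b a i "adjacent J" k] ne that by (auto simp: adjacent_def)
  have sub: "?C b \<subseteq> S - {a}" if b: "b \<in> ?N" for b
  proof
    fix v assume v: "v \<in> ?C b"
    have "v \<noteq> a" using branch_avoids[OF ne[OF b] v] .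
    moreover have "v \<in> S"
      using S once[of b v] v b by (auto simp: neighbours_def)
    ultimately show "v \<in> S - {a}" by simp
  qed
  have "B a a * (J $ a $ a + (\<Sum>b\<in>?N. - (J $ a $ b * deleted_inv J a b b * J $ b $ a))) = 1"
  proof (rule inverts_on_diagonal_branches[where A = ?A and C = ?C and G = "\<lambda>_. deleted_inv J a",
        OF inv _ a])
    show "?N = {b \<in> S - {a}. J $ a $ b \<noteq> 0}"
      by (auto simp: neighbours_def adjacent_def)
    show "J $ i $ a = 0" if "b \<in> ?N" "i \<in> ?C b" "i \<noteq> b" for b i
      using once[of b i] that branch_avoids[OF ne, of b i] sym[of i a] by (auto simp: adjacent_def)
    \<comment> \<open>Each branch is a block of \<open>UNIV - {a}\<close>, whatever \<open>S\<close>
      is, so one matrix serves all branches and the messages do not depend on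
      \<open>S\<close>.\<close>
    show "inverts_on (?C b) ?A (deleted_inv J a)" if b: "b \<in> ?N" for b
    proof (rule inverts_on_block[OF inverts_on_deleted_inv[OF J]])
      show "J $ i $ k = 0 \<and> J $ k $ i = 0" if "i \<in> ?C b" "k \<in> UNIV - {a} - ?C b" for i k
        using closed[OF b, of i k] that sym[of i k] by auto
    qed (use sub[OF b] in auto)
  qed (use sub closed branch_self in auto)
  then have "inverse (B a a) =
      J $ a $ a + (\<Sum>b\<in>?N. - (J $ a $ b * deleted_inv J a b b * J $ b $ a))"
    by (rule inverse_unique)
  then show ?thesis
    by (simp add: J_message_def J_cavity_def)
qed

theorem mainTheorem3:
  fixes J :: "real^'n^'n"
  assumes "information_matrix J"
    and "graph_tree (adjacent J)"
  shows "(\<forall>\<alpha>. J_hat J \<alpha> = J $ \<alpha> $ \<alpha> + (\<Sum>\<beta>\<in>neighbours J \<alpha>. J_message J \<beta> \<alpha>)) \<and>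
         (\<forall>\<alpha>. \<forall>\<beta>\<in>neighbours J \<alpha>.
            J_cavity J \<beta> \<alpha> =
              J $ \<beta> $ \<beta> + (\<Sum>\<delta>\<in>neighbours J \<beta> - {\<alpha>}. J_message J \<delta> \<beta>))"
proof (intro conjI allI ballI)
  fix \<alpha>
  show "J_hat J \<alpha> = J $ \<alpha> $ \<alpha> + (\<Sum>\<beta>\<in>neighbours J \<alpha>. J_message J \<beta> \<alpha>)"
    using tree_inverse_diagonal[OF assms inverts_on_matrix_inv[OF assms(1)], of \<alpha>]
    by (simp add: J_hat_def inverse_eq_divide)
next
  fix \<alpha> \<beta> assume "\<beta> \<in> neighbours J \<alpha>"
  \<comment> \<open>The centre is now \<beta>, and the deleted vertex \<alpha> is one of its
    neighbours by symmetry of \<open>J\<close>.\<close>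
  then have "\<beta> \<in> UNIV - {\<alpha>}" and "- (UNIV - {\<alpha>}) \<subseteq> neighbours J \<beta>"
    using information_matrix_sym[OF assms(1), of \<alpha> \<beta>] by (auto simp: neighbours_def adjacent_def)
  moreover have "neighbours J \<beta> \<inter> (UNIV - {\<alpha>}) = neighbours J \<beta> - {\<alpha>}"
    by auto
  ultimately show "J_cavity J \<beta> \<alpha> =
      J $ \<beta> $ \<beta> + (\<Sum>\<delta>\<in>neighbours J \<beta> - {\<alpha>}. J_message J \<delta> \<beta>)"
    using tree_inverse_diagonal[OF assms inverts_on_deleted_inv[OF assms(1)], of \<beta> \<alpha>]
    by (simp add: J_cavity_def)
qed

end
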